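(* Let $G=(V,E)$ be a simple undirected graph of $n$ vertices and $m$ edges, and let $B$ denote its bandwidth on a vertex order. For a tuple $(L_v)_{v\in V}$ of $[l]$-lists, we can decide the list-colorability of $G$ on $(L_v)_{v\in V}$ in time $O\bigl((2l)^{B+2}(m+ln)\bigr)$.
   Context: $[l]=\{0,1,\ldots,l-1\}$ is regarded as a set of $l$ distinct colors; an $[l]$-list is a subset $L\subset[l]$. $G$ is list-colorable on $(L_v)_{v\in V}$ if there is a tuple $(a_v)_{v\in V}$ of colors with $a_v\in L_v$ for every vertex $v$ and $a_u\neq a_v$ for every edge $uv\in E$. The vertices are ordered $v_1,\ldots,v_n$; the bandwidth of $G$ on this order is $B=\max_{v_iv_j\in E}|i-j|$ (with $B=0$ if $E=\emptyset$); it depends on the order and is not minimized. Cost conventions: the problem is treated as a system of equations $p=0$ with $p$ a sum of clauses over $\mathbb{F}_2$ in Boolean variables (a clause being $0$, $1$ or a product of literals $x$, $x+1$ with distinct underlying variables); a clause is stored as a hash set ($\emptyset$ for $0$, $\{1\}$ for $1$, and the set of its literals otherwise); search and delete in a hash set cost $O(1)$; for a set $\mathcal{P}$ of Boolean polynomials, computing $\mathcal{N}(\mathcal{P})$ (equal to $\{1\}$ if $1\in\mathcal{P}$ and to $\mathcal{P}\setminus\{0\}$ otherwise) is considered to cost $O(1)$; binary operations on $\mathbb{F}_2$ cost $O(1)$. *)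

theory Defs
  imports Main
begin

section \<open>List colouring\<close>

text \<open>Edges are two-element sets of vertices, so there are no loops and no multiple edges.\<close>

definition simple_graph :: "'v set \<Rightarrow> 'v set set \<Rightarrow> bool" where
  "simple_graph V E \<longleftrightarrow> finite V \<and> (\<forall>e\<in>E. e \<subseteq> V \<and> card e = 2)"

definition list_colorable :: "'v set \<Rightarrow> 'v set set \<Rightarrow> ('v \<Rightarrow> nat set) \<Rightarrow> bool" where
  "list_colorable V E L \<longleftrightarrow>
     (\<exists>a. (\<forall>v\<in>V. a v \<in> L v) \<and> (\<forall>u v. {u, v} \<in> E \<longrightarrow> a u \<noteq> a v))"

definition vertex_order :: "'v set \<Rightarrow> 'v list \<Rightarrow> bool" where
  "vertex_order V vs \<longleftrightarrow> distinct vs \<and> set vs = V"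

text \<open>The bandwidth refers to the given order \<open>vs\<close> (no minimisation over orders); the inserted 0
  is its value on an edgeless graph.\<close>

definition bandwidth :: "'v list \<Rightarrow> 'v set set \<Rightarrow> nat" where
  "bandwidth vs E =
     Max (insert 0 {nat \<bar>int i - int j\<bar> | i j.
            i < length vs \<and> j < length vs \<and> {vs ! i, vs ! j} \<in> E})"


section \<open>A random access machine with hash sets\<close>

text \<open>
  Algorithms are programs of a unit-cost random access machine over the natural numbers, with
  structured control flow. Besides scalar variables and arrays it has hash sets, again arranged in
  arrays: \<open>hset s h i\<close> is the content of the \<open>i\<close>-th hash set in the array \<open>h\<close>. A program mentions
  only finitely many names. There is no multiplication or division of numbers.

  Hash sets contain codes, that is, numbers. The codes 0 and 1 stand for the constant polynomials
  0 and 1; all other codes are free for the program to use, e.g. for literals or for the addresses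
  of stored polynomials. In particular a clause can be stored as the empty set (for 0), as \<open>{1}\<close>
  (for 1), or as the set of the codes of its literals.
\<close>

type_synonym vname = string

record state =
  reg :: "vname \<Rightarrow> nat"
  arr :: "vname \<Rightarrow> nat \<Rightarrow> nat"
  hset :: "vname \<Rightarrow> nat \<Rightarrow> nat set"

datatype exp =
    Const nat
  | Var vname
  | Arr vname exp
  | Add exp exp
  | Sub exp exp
  | Eq exp exp
  | Less exp exp
  | Xor exp exp
  | And exp exp
  | Search vname exp exp

text \<open>\<open>Sub\<close> is truncated at 0. \<open>Xor\<close> and \<open>And\<close> are addition and multiplication of the two-element
  field; every nonzero operand counts as 1. Reducing operands modulo 2 instead would give unit-cost access
  to the parity of a large number.\<close>

fun val :: "exp \<Rightarrow> state \<Rightarrow> nat" where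
  "val (Const k) s = k"
| "val (Var x) s = reg s x"
| "val (Arr a e) s = arr s a (val e s)"
| "val (Add e f) s = val e s + val f s"
| "val (Sub e f) s = val e s - val f s"
| "val (Eq e f) s = of_bool (val e s = val f s)"
| "val (Less e f) s = of_bool (val e s < val f s)"
| "val (Xor e f) s = of_bool ((val e s \<noteq> 0) \<noteq> (val f s \<noteq> 0))"
| "val (And e f) s = of_bool (val e s \<noteq> 0 \<and> val f s \<noteq> 0)"
| "val (Search h i x) s = of_bool (val x s \<in> hset s h (val i s))"

fun cost :: "exp \<Rightarrow> nat" where
  "cost (Const k) = 1"
| "cost (Var x) = 1"
| "cost (Arr a e) = 1 + cost e"
| "cost (Add e f) = 1 + cost e + cost f"
| "cost (Sub e f) = 1 + cost e + cost f"
| "cost (Eq e f) = 1 + cost e + cost f"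
| "cost (Less e f) = 1 + cost e + cost f"
| "cost (Xor e f) = 1 + cost e + cost f"
| "cost (And e f) = 1 + cost e + cost f"
| "cost (Search h i x) = 1 + cost i + cost x"

datatype com =
    Skip
  | Assign vname exp
  | Store vname exp exp
  | Clear vname exp
  | Insert vname exp exp
  | Delete vname exp exp
  | Norm vname exp
  | Seq com com
  | If exp com com
  | While exp com

definition set_reg :: "vname \<Rightarrow> nat \<Rightarrow> state \<Rightarrow> state" where
  "set_reg x k s = s\<lparr>reg := (reg s)(x := k)\<rparr>"

definition set_arr :: "vname \<Rightarrow> nat \<Rightarrow> nat \<Rightarrow> state \<Rightarrow> state" where
  "set_arr a i k s = s\<lparr>arr := (arr s)(a := (arr s a)(i := k))\<rparr>"

definition set_hset :: "vname \<Rightarrow> nat \<Rightarrow> nat set \<Rightarrow> state \<Rightarrow> state" where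
  "set_hset h i X s = s\<lparr>hset := (hset s)(h := (hset s h)(i := X))\<rparr>"

text \<open>The operator \<open>\<N>\<close> on (codes of) sets of Boolean polynomials.\<close>

definition normalize_set :: "nat set \<Rightarrow> nat set" where
  "normalize_set P = (if 1 \<in> P then {1} else P - {0})"

text \<open>\<open>big_step c s t s'\<close>: started in \<open>s\<close>, the program \<open>c\<close> terminates in \<open>s'\<close> at total cost \<open>t\<close>.\<close>

inductive big_step :: "com \<Rightarrow> state \<Rightarrow> nat \<Rightarrow> state \<Rightarrow> bool" where
  Skip: "big_step Skip s 1 s"
| Assign: "big_step (Assign x e) s (1 + cost e) (set_reg x (val e s) s)"
| Store: "big_step (Store a i e) s (1 + cost i + cost e) (set_arr a (val i s) (val e s) s)"
| Clear: "big_step (Clear h i) s (1 + cost i) (set_hset h (val i s) {} s)"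
| Insert: "big_step (Insert h i e) s (1 + cost i + cost e)
            (set_hset h (val i s) (insert (val e s) (hset s h (val i s))) s)"
| Delete: "big_step (Delete h i e) s (1 + cost i + cost e)
            (set_hset h (val i s) (hset s h (val i s) - {val e s}) s)"
| Norm: "big_step (Norm h i) s (1 + cost i)
            (set_hset h (val i s) (normalize_set (hset s h (val i s))) s)"
| Seq: "big_step c s t s' \<Longrightarrow> big_step d s' u s'' \<Longrightarrow> big_step (Seq c d) s (t + u) s''"
| IfTrue: "val b s \<noteq> 0 \<Longrightarrow> big_step c s t s' \<Longrightarrow> big_step (If b c d) s (1 + cost b + t) s'"
| IfFalse: "val b s = 0 \<Longrightarrow> big_step d s t s' \<Longrightarrow> big_step (If b c d) s (1 + cost b + t) s'"
| WhileFalse: "val b s = 0 \<Longrightarrow> big_step (While b c) s (1 + cost b) s"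
| WhileTrue: "val b s \<noteq> 0 \<Longrightarrow> big_step c s t s' \<Longrightarrow> big_step (While b c) s' u s'' \<Longrightarrow>
            big_step (While b c) s (1 + cost b + t + u) s''"

inductive_cases big_step_cases:
  "big_step Skip s t s'" "big_step (Assign x e) s t s'" "big_step (Store a i e) s t s'"
  "big_step (Clear h i) s t s'" "big_step (Insert h i e) s t s'" "big_step (Delete h i e) s t s'"
  "big_step (Norm h i) s t s'" "big_step (Seq c d) s t s'" "big_step (If b c d) s t s'"

inductive_cases big_step_WhileE: "big_step (While b c) s t s'"

lemma big_step_deterministic:
  "big_step c s t s' \<Longrightarrow> big_step c s u s'' \<Longrightarrow> u = t \<and> s'' = s'"
proof (induction arbitrary: u s'' rule: big_step.induct)
  case (Seq c s t s' d v s2)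
  from Seq.prems show ?case
    by (rule big_step_cases) (auto dest!: Seq.IH)
next
  case (IfTrue b s c t s' d)
  from IfTrue.prems show ?case
    by (rule big_step_cases) (use IfTrue.hyps in \<open>auto dest: IfTrue.IH\<close>)
next
  case (IfFalse b s d t s' c)
  from IfFalse.prems show ?case
    by (rule big_step_cases) (use IfFalse.hyps in \<open>auto dest: IfFalse.IH\<close>)
next
  case (WhileTrue b s c t s' v s2)
  from WhileTrue.prems show ?case
    by (rule big_step_WhileE) (use WhileTrue.hyps in \<open>auto dest!: WhileTrue.IH\<close>)
next
  case (WhileFalse b s c)
  from WhileFalse.prems show ?case
    by (rule big_step_WhileE) (use WhileFalse.hyps in auto)
qed (erule big_step_cases; simp)+


section \<open>Encoding of problem instances\<close>

text \<open>Vertices are given to the machine by their positions in the order. \<open>es\<close> lists every edge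
  exactly once, as a pair of positions in either orientation; the edges may come in any order.\<close>

definition edge_list :: "'v list \<Rightarrow> 'v set set \<Rightarrow> (nat \<times> nat) list \<Rightarrow> bool" where
  "edge_list vs E es \<longleftrightarrow>
     (\<forall>(i, j)\<in>set es. i < length vs \<and> j < length vs) \<and>
     bij_betw (\<lambda>k. {vs ! fst (es ! k), vs ! snd (es ! k)}) {..<length es} E"

text \<open>The bandwidth is not part of the input. All cells that carry no input are 0 or empty.\<close>

definition input_state ::
    "nat \<Rightarrow> 'v list \<Rightarrow> (nat \<times> nat) list \<Rightarrow> ('v \<Rightarrow> nat set) \<Rightarrow> state" where
  "input_state l vs es L =
     \<lparr>reg = (\<lambda>_. 0)(''n'' := length vs, ''m'' := length es, ''l'' := l),
      arr = (\<lambda>_ _. 0)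
        (''eu'' := (\<lambda>k. if k < length es then fst (es ! k) else 0),
         ''ev'' := (\<lambda>k. if k < length es then snd (es ! k) else 0)),
      hset = (\<lambda>_ _. {})(''L'' := (\<lambda>i. if i < length vs then L (vs ! i) else {}))\<rparr>"

definition answer :: "state \<Rightarrow> nat" where
  "answer s = reg s ''out''"

end

theory Submission
  imports Defs
begin

text \<open>
  Dynamic programming along the vertex order. Since no edge is longer than the bandwidth \<open>B\<close>, a
  proper colouring of the first \<open>i\<close> vertices matters for the later ones only through the colours of
  the last \<open>B\<close> vertices, of which there are at most \<open>l ^ B\<close> patterns. Passing from \<open>i\<close> to \<open>i + 1\<close> tests
  every pattern with every colour of vertex \<open>i\<close> against the at most \<open>B\<close> possible earlier neighbours,
  at cost \<open>O(l ^ (B + 1) * (B + 1))\<close>, and \<open>B + 1 \<le> 2 ^ B\<close>. Patterns are coded as base \<open>l\<close> numerals, whose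
  digits are read off precomputed tables of quotients and remainders, as the machine cannot divide.
\<close>

section \<open>Reasoning about programs and their cost\<close>

text \<open>As \<open>big_step\<close> is deterministic, asserting one run speaks about every run,
  so this acts as a weakest precondition that also tracks cost.\<close>

definition runs :: "com \<Rightarrow> state \<Rightarrow> (nat \<Rightarrow> state \<Rightarrow> bool) \<Rightarrow> bool" where
  "runs c s Q \<longleftrightarrow> (\<exists>t s'. big_step c s t s' \<and> Q t s')"

lemma runs_mono: "runs c s Q \<Longrightarrow> (\<And>t s'. Q t s' \<Longrightarrow> R t s') \<Longrightarrow> runs c s R"
  unfolding runs_def by blast

text \<open>Keeps the simplifier from rewriting the postcondition before the state it is applied to is known.\<close>

lemma runs_cong [cong]: "c = d \<Longrightarrow> s = s' \<Longrightarrow> runs c s Q = runs d s' Q"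
  by simp

lemma runs_simps:
  "runs Skip s Q \<longleftrightarrow> Q 1 s"
  "runs (Assign x e) s Q \<longleftrightarrow> Q (1 + cost e) (set_reg x (val e s) s)"
  "runs (Store a i e) s Q \<longleftrightarrow> Q (1 + cost i + cost e) (set_arr a (val i s) (val e s) s)"
  "runs (Insert h i e) s Q \<longleftrightarrow> Q (1 + cost i + cost e)
     (set_hset h (val i s) (insert (val e s) (hset s h (val i s))) s)"
  "runs (Seq c d) s Q \<longleftrightarrow> runs c s (\<lambda>t s'. runs d s' (\<lambda>u. Q (t + u)))"
  "runs (If b c d) s Q \<longleftrightarrow>
     (if val b s \<noteq> 0 then runs c s (\<lambda>t. Q (1 + cost b + t))
      else runs d s (\<lambda>t. Q (1 + cost b + t)))"
  unfolding runs_def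
proof goal_cases
  case 1
  show ?case by (metis big_step.Skip big_step_deterministic)
next
  case 2
  show ?case by (metis big_step.Assign big_step_deterministic)
next
  case 3
  show ?case by (metis big_step.Store big_step_deterministic)
next
  case 4
  show ?case by (metis big_step.Insert big_step_deterministic)
next
  case 5
  show ?case by (blast intro: big_step.Seq elim: big_step_cases)
next
  case 6
  show ?case
    by (cases "val b s = 0")
      (auto dest: big_step.IfTrue[simplified] big_step.IfFalse[simplified] elim!: big_step_cases)
qed

text \<open>The index of \<open>I\<close> counts completed rounds. A bound \<open>T\<close> per
  round then yields termination and cost at once: \<open>n\<close> rounds of guard and body, plus
  the failing last test.\<close>

lemma runs_while:
  assumes step: "\<And>k s. k < n \<Longrightarrow> I k s \<Longrightarrow>
      val b s \<noteq> 0 \<and> runs c s (\<lambda>t s'. t \<le> T \<and> I (Suc k) s')"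
    and exit: "\<And>s. I n s \<Longrightarrow> val b s = 0"
    and init: "I 0 s"
  shows "runs (While b c) s (\<lambda>t s'. t \<le> n * (1 + cost b + T) + 1 + cost b \<and> I n s')"
proof -
  have "runs (While b c) s (\<lambda>t s'. t \<le> j * (1 + cost b + T) + 1 + cost b \<and> I n s')"
    if "I k s" "k + j = n" for j k s
    using that
  proof (induction j arbitrary: k s)
    case 0
    then show ?case
      using exit[of s] unfolding runs_def by (auto intro!: exI big_step.WhileFalse)
  next
    case (Suc j)
    obtain t s' where 1: "val b s \<noteq> 0" "big_step c s t s'" "t \<le> T" "I (Suc k) s'"
      using step[of k s] Suc.prems unfolding runs_def by auto
    obtain u s'' where 2: "big_step (While b c) s' u s''"
      "u \<le> j * (1 + cost b + T) + 1 + cost b" "I n s''"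
      using Suc.IH[OF 1(4)] Suc.prems unfolding runs_def by auto
    show ?case
      unfolding runs_def using big_step.WhileTrue[OF 1(1,2) 2(1)] 1(3) 2(2,3)
      by (intro exI[of _ "1 + cost b + t + u"] exI[of _ s'']) auto
  qed
  from this[OF init] show ?thesis by simp
qed

section \<open>State updates and frame conditions\<close>

lemma state_upd_simps [simp]:
  "reg (set_reg x k s) = (reg s)(x := k)"
  "arr (set_reg x k s) = arr s"
  "hset (set_reg x k s) = hset s"
  "reg (set_arr a i k s) = reg s"
  "arr (set_arr a i k s) = (arr s)(a := (arr s a)(i := k))"
  "hset (set_arr a i k s) = hset s"
  "reg (set_hset h i X s) = reg s"
  "arr (set_hset h i X s) = arr s"
  "hset (set_hset h i X s) = (hset s)(h := (hset s h)(i := X))"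
  by (simp_all add: set_reg_def set_arr_def set_hset_def)

text \<open>The sets are upper bounds on the names a program may write, so that invariants inherit
  all other facts from the initial state.\<close>

definition frame :: "vname set \<Rightarrow> vname set \<Rightarrow> vname set \<Rightarrow> state \<Rightarrow> state \<Rightarrow> bool" where
  "frame X A H s s' \<longleftrightarrow>
     (\<forall>x. x \<notin> X \<longrightarrow> reg s' x = reg s x) \<and>
     (\<forall>a. a \<notin> A \<longrightarrow> arr s' a = arr s a) \<and>
     (\<forall>h. h \<notin> H \<longrightarrow> hset s' h = hset s h)"

lemma frame_refl: "frame X A H s s"
  by (simp add: frame_def)

lemma frameD:
  assumes "frame X A H s s'"
  shows "x \<notin> X \<Longrightarrow> reg s' x = reg s x"
    and "a \<notin> A \<Longrightarrow> arr s' a = arr s a"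
    and "h \<notin> H \<Longrightarrow> hset s' h = hset s h"
  using assms by (simp_all add: frame_def)

lemma frame_trans:
  assumes "frame X A H s s'" "frame X' A' H' s' s''" "X \<subseteq> Y" "X' \<subseteq> Y" "A \<subseteq> Z" "A' \<subseteq> Z"
    "H \<subseteq> K" "H' \<subseteq> K"
  shows "frame Y Z K s s''"
  using assms unfolding frame_def subset_iff by metis


section \<open>The program\<close>

definition incr :: "vname \<Rightarrow> com" where
  "incr x = Assign x (Add (Var x) (Const 1))"

text \<open>Truncated subtraction puts, for each edge, the distance to the earlier endpoint into the set
  \<open>D\<close> of the later one, and a harmless 0 into the set of the earlier one.\<close>

definition scan_edges :: com where
  "scan_edges =
     (let e = Arr ''eu'' (Var ''k''); f = Arr ''ev'' (Var ''k'') in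
      While (Less (Var ''k'') (Var ''m''))
        (Seq (Insert ''D'' e (Sub e f))
        (Seq (Insert ''D'' f (Sub f e))
        (Seq (Assign ''d'' (Add (Sub e f) (Sub f e)))
        (Seq (If (Less (Var ''B'') (Var ''d'')) (Assign ''B'' (Var ''d'')) Skip)
        (incr ''k''))))))"

text \<open>Multiplication by \<open>l\<close> is repeated addition. \<open>P\<close> trails
  \<open>N\<close> by one round, so \<open>B + 1\<close> rounds leave \<open>l ^ B\<close> in
  \<open>P\<close> and \<open>l ^ (B + 1)\<close> in \<open>N\<close>.\<close>

definition powers :: com where
  "powers =
     Seq (Assign ''N'' (Const 1))
     (While (Less (Var ''b'') (Add (Var ''B'') (Const 1)))
       (Seq (Assign ''P'' (Var ''N''))
       (Seq (Assign ''N'' (Const 0))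
       (Seq (Assign ''j'' (Const 0))
       (Seq (While (Less (Var ''j'') (Var ''l''))
              (Seq (Assign ''N'' (Add (Var ''N'') (Var ''P''))) (incr ''j'')))
       (incr ''b''))))))"

text \<open>An odometer: quotient and remainder modulo \<open>p\<close> are advanced along with a
  counter, which replaces division.\<close>

definition count_up :: "vname \<Rightarrow> vname \<Rightarrow> vname \<Rightarrow> com" where
  "count_up q r p =
     Seq (incr r) (If (Eq (Var r) (Var p)) (Seq (Assign r (Const 0)) (incr q)) Skip)"

definition tables :: com where
  "tables =
     While (Less (Var ''x'') (Var ''N''))
       (Seq (Store ''quo'' (Var ''x'') (Var ''q''))
       (Seq (Store ''dig'' (Var ''x'') (Var ''r''))
       (Seq (count_up ''q'' ''r'' ''l'')
       (incr ''x''))))"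

text \<open>The lowest digit of \<open>w\<close> belongs to the vertex farthest back, so stripping
  digits from \<open>y\<close> goes with distances \<open>d\<close> falling from \<open>B\<close> to
  1.\<close>

definition check_window :: com where
  "check_window =
     Seq (Assign ''ok'' (And (Search ''S'' (Var ''i'') (Var ''w'')) (Search ''L'' (Var ''i'') (Var ''c''))))
     (Seq (Assign ''y'' (Var ''w''))
     (Seq (Assign ''d'' (Var ''B''))
     (While (Less (Const 0) (Var ''d''))
       (Seq (If (And (Search ''D'' (Var ''i'') (Var ''d'')) (Eq (Arr ''dig'' (Var ''y'')) (Var ''c'')))
              (Assign ''ok'' (Const 0)) Skip)
       (Seq (Assign ''y'' (Arr ''quo'' (Var ''y'')))
       (Assign ''d'' (Sub (Var ''d'') (Const 1))))))))"

definition layer :: com where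
  "layer =
     Seq (Assign ''out'' (Const 0))
     (Seq (Assign ''x'' (Const 0))
     (Seq (Assign ''c'' (Const 0))
     (Seq (Assign ''w'' (Const 0))
     (While (Less (Var ''x'') (Var ''N''))
       (Seq check_window
       (Seq (If (Var ''ok'')
              (Seq (Insert ''S'' (Add (Var ''i'') (Const 1)) (Arr ''quo'' (Var ''x'')))
                (Assign ''out'' (Const 1))) Skip)
       (Seq (count_up ''c'' ''w'' ''P'')
       (incr ''x''))))))))"

text \<open>The code 0 describes the window before the first vertex: missing positions are padded
  with colour 0, which no positive distance in \<open>D\<close> reaches.\<close>

definition layers :: com where
  "layers =
     Seq (Insert ''S'' (Const 0) (Const 0))
     (Seq (Assign ''out'' (Const 1))
     (While (Less (Var ''i'') (Var ''n'')) (Seq layer (incr ''i''))))"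

text \<open>The claimed bound is constant if \<open>n\<close> or \<open>l\<close> is 0, so these
  cases leave before any loop; \<open>Skip\<close> keeps the initial value 0 of
  \<open>out\<close>.\<close>

definition color_prog :: com where
  "color_prog =
     If (Eq (Var ''n'') (Const 0)) (Assign ''out'' (Const 1))
       (If (Eq (Var ''l'') (Const 0)) Skip
         (Seq scan_edges (Seq powers (Seq tables layers))))"


section \<open>Running the program\<close>

text \<open>Of two opposite truncated differences at least one is 0, so their sum is the length of
  the edge.\<close>

lemma scan_edges_runs:
  assumes "reg s ''k'' = 0" "reg s ''B'' = 0" "hset s ''D'' = (\<lambda>_. {})" "reg s ''m'' = m"
  shows "runs scan_edges s (\<lambda>t s'. t \<le> m * 50 + 4 \<and> frame {''k'', ''d'', ''B''} {} {''D''} s s' \<and>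
    reg s' ''B'' = Max (insert 0 ((\<lambda>k. (arr s ''eu'' k - arr s ''ev'' k) + (arr s ''ev'' k - arr s ''eu'' k)) ` {..<m})) \<and>
    (\<forall>i. hset s' ''D'' i = {arr s ''eu'' k - arr s ''ev'' k | k. k < m \<and> arr s ''eu'' k = i} \<union>
       {arr s ''ev'' k - arr s ''eu'' k | k. k < m \<and> arr s ''ev'' k = i}))"
proof -
  define e where "e = arr s ''eu''"
  define f where "f = arr s ''ev''"
  define I where "I = (\<lambda>j s'. reg s' ''k'' = j \<and> frame {''k'', ''d'', ''B''} {} {''D''} s s' \<and>
    reg s' ''B'' = Max (insert 0 ((\<lambda>k. (e k - f k) + (f k - e k)) ` {..<j})) \<and>
    (\<forall>i. hset s' ''D'' i = {e k - f k | k. k < j \<and> e k = i} \<union> {f k - e k | k. k < j \<and> f k = i}))"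
  show ?thesis
    unfolding scan_edges_def Let_def
  proof (rule runs_mono, rule runs_while[where n = m and I = I and T = 46], goal_cases)
    case (1 j s')
    have F: "frame {''k'', ''d'', ''B''} {} {''D''} s s'" and k: "reg s' ''k'' = j"
      and Bj: "reg s' ''B'' = Max (insert 0 ((\<lambda>k. (e k - f k) + (f k - e k)) ` {..<j}))"
      and Dj: "\<And>i. hset s' ''D'' i = {e k - f k | k. k < j \<and> e k = i} \<union> {f k - e k | k. k < j \<and> f k = i}"
      using 1(2) unfolding I_def by blast+
    have fr: "reg s' ''k'' = j" "arr s' ''eu'' = e" "arr s' ''ev'' = f" "reg s' ''m'' = m"
      using k frameD[OF F] assms by (simp_all add: e_def f_def)
    have mx: "Max (insert 0 ((\<lambda>k. (e k - f k) + (f k - e k)) ` {..<Suc j})) =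
      max (Max (insert 0 ((\<lambda>k. (e k - f k) + (f k - e k)) ` {..<j}))) ((e j - f j) + (f j - e j))"
      unfolding lessThan_Suc image_insert insert_commute[of 0]
      by (subst Max_insert) (auto simp: max.commute)
    \<comment> \<open>Separates the invariant from symbolic execution: these four effects of a round
      suffice, whichever branch was taken.\<close>
    have I: "I (Suc j) s''"
      if u: "frame {''k'', ''d'', ''B''} {} {''D''} s' s''" "reg s'' ''k'' = Suc j"
        "reg s'' ''B'' = max (reg s' ''B'') ((e j - f j) + (f j - e j))"
        "\<And>i. hset s'' ''D'' i = hset s' ''D'' i \<union> (if i = e j then {e j - f j} else {}) \<union>
          (if i = f j then {f j - e j} else {})" for s''
      unfolding I_def
    proof (intro conjI allI)
      show "frame {''k'', ''d'', ''B''} {} {''D''} s s''"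
        by (rule frame_trans[OF F u(1)]) auto
      show "hset s'' ''D'' i = {e k - f k | k. k < Suc j \<and> e k = i} \<union> {f k - e k | k. k < Suc j \<and> f k = i}" for i
      proof -
        have "{g k | k. k < Suc j \<and> h k = i} = {g k | k. k < j \<and> h k = i} \<union> (if i = h j then {g j} else {})"
          for g h :: "nat \<Rightarrow> nat"
          by (auto simp: less_Suc_eq)
        then show ?thesis unfolding u(4) Dj by (simp only: Un_ac)
      qed
    qed (simp_all only: u(2,3) Bj mx)
    have "reg s' ''k'' < reg s' ''m''" using 1 fr by simp
    then show ?case using fr
      by (simp add: runs_simps incr_def) (intro conjI impI; rule I; auto simp: frame_def)
  next
    case (2 s')
    have "frame {''k'', ''d'', ''B''} {} {''D''} s s'" "reg s' ''k'' = m"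
      using 2 unfolding I_def by blast+
    then show ?case using assms frameD[of _ _ _ s s'] by simp
  next
    case 3
    then show ?case using assms by (simp add: I_def frame_refl)
  next
    case (4 t s')
    then show ?case by (simp add: I_def e_def f_def)
  qed
qed

lemma powers_runs:
  assumes "reg s ''b'' = 0" "reg s ''B'' = B" "reg s ''l'' = l"
  shows "runs powers s (\<lambda>t s'. t \<le> (B + 1) * (l * 12 + 30) + 10 \<and>
    frame {''N'', ''P'', ''b'', ''j''} {} {} s s' \<and>
    reg s' ''P'' = l ^ B \<and> reg s' ''N'' = l ^ (B + 1))"
proof -
  \<comment> \<open>\<open>P\<close> holds a power only after the first round, hence the guard
    \<open>0 < j\<close>.\<close>
  define I where "I = (\<lambda>j s'. reg s' ''b'' = j \<and> frame {''N'', ''P'', ''b'', ''j''} {} {} s s' \<and>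
    reg s' ''N'' = l ^ j \<and> (0 < j \<longrightarrow> reg s' ''P'' = l ^ (j - 1)))"
  show ?thesis
    unfolding powers_def runs_simps
  proof (rule runs_mono, rule runs_while[where n = "B + 1" and I = I and T = "l * 12 + 20"], goal_cases)
    case (1 j s')
    define J where "J = (\<lambda>i s''. reg s'' ''j'' = i \<and> frame {''N'', ''P'', ''j''} {} {} s' s'' \<and>
      reg s'' ''N'' = i * l ^ j \<and> reg s'' ''P'' = l ^ j)"
    have fr: "reg s' ''b'' = j" "reg s' ''N'' = l ^ j" "reg s' ''l'' = l" "reg s' ''B'' = B"
      using 1 assms by (simp_all add: I_def frame_def)
    have "runs (While (Less (Var ''j'') (Var ''l''))
              (Seq (Assign ''N'' (Add (Var ''N'') (Var ''P''))) (incr ''j''))) s''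
       (\<lambda>t s'. t \<le> l * (1 + cost (Less (Var ''j'') (Var ''l'')) + 8) + 1 + cost (Less (Var ''j'') (Var ''l'')) \<and> J l s')"
      if "J 0 s''" for s''
      by (rule runs_while[where I = J])
        (use that fr in \<open>auto simp: J_def runs_simps incr_def frame_def\<close>)
    note loop = this
    have J0: "J 0 (set_reg ''j'' 0 (set_reg ''N'' 0 (set_reg ''P'' (l ^ j) s')))"
      by (simp add: J_def frame_def)
    have "runs (While (Less (Var ''j'') (Var ''l''))
              (Seq (Assign ''N'' (Add (Var ''N'') (Var ''P''))) (incr ''j''))) 
       (set_reg ''j'' 0 (set_reg ''N'' 0 (set_reg ''P'' (l ^ j) s')))
       (\<lambda>t s''. t + 10 \<le> l * 12 + 20 \<and> I (Suc j) (set_reg ''b'' (Suc (reg s'' ''b'')) s''))"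
      by (rule runs_mono[OF loop[OF J0]]) (use 1 fr in \<open>auto simp: I_def J_def frame_def\<close>)
    then show ?case using 1 fr
      by (auto simp: runs_simps incr_def ac_simps elim!: runs_mono)
  next
    case (2 s')
    then show ?case using assms by (simp_all add: I_def frame_def)
  next
    case 3
    then show ?case using assms by (simp add: I_def frame_def)
  next
    case (4 t s')
    then show ?case by (simp add: I_def algebra_simps)
  qed
qed

section \<open>Division with remainder by counting\<close>

lemma div_mod_Suc:
  fixes x p :: nat
  assumes "p > 0"
  shows "Suc x div p = (if Suc (x mod p) = p then Suc (x div p) else x div p)"
    and "Suc x mod p = (if Suc (x mod p) = p then 0 else Suc (x mod p))"
  using assms by (simp_all add: div_Suc mod_Suc)

lemma count_up_runs:
  assumes "q \<noteq> r" "q \<noteq> p" "r \<noteq> p" "reg s p > 0" "reg s q = x div reg s p" "reg s r = x mod reg s p"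
  shows "runs (count_up q r p) s (\<lambda>t s'. t \<le> 20 \<and> frame {q, r} {} {} s s' \<and>
    reg s' q = Suc x div reg s p \<and> reg s' r = Suc x mod reg s p)"
  using assms by (auto simp: count_up_def incr_def runs_simps frame_def div_mod_Suc)

lemma tables_runs:
  assumes "reg s ''x'' = 0" "reg s ''q'' = 0" "reg s ''r'' = 0" "reg s ''l'' = l" "reg s ''N'' = N" "l > 0"
  shows "runs tables s (\<lambda>t s'. t \<le> N * 40 + 4 \<and>
    frame {''x'', ''q'', ''r''} {''quo'', ''dig''} {} s s' \<and>
    (\<forall>y<N. arr s' ''quo'' y = y div l \<and> arr s' ''dig'' y = y mod l))"
proof -
  define I where "I = (\<lambda>j s'. reg s' ''x'' = j \<and> reg s' ''q'' = j div l \<and> reg s' ''r'' = j mod l \<and>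
    frame {''x'', ''q'', ''r''} {''quo'', ''dig''} {} s s' \<and>
    (\<forall>y<j. arr s' ''quo'' y = y div l \<and> arr s' ''dig'' y = y mod l))"
  show ?thesis
    unfolding tables_def
  proof (rule runs_mono, rule runs_while[where n = N and I = I and T = 36], goal_cases)
    case (1 j s')
    then have fr: "reg s' ''x'' = j" "reg s' ''q'' = j div l" "reg s' ''r'' = j mod l"
      "reg s' ''l'' = l" "reg s' ''N'' = N"
      using assms by (simp_all add: I_def frame_def)
    define s1 where "s1 = set_arr ''dig'' j (j mod l) (set_arr ''quo'' j (j div l) s')"
    have "runs (count_up ''q'' ''r'' ''l'') s1 (\<lambda>t s''. t \<le> 20 \<and> frame {''q'', ''r''} {} {} s1 s'' \<and>
      reg s'' ''q'' = Suc j div reg s1 ''l'' \<and> reg s'' ''r'' = Suc j mod reg s1 ''l'')"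
      by (rule count_up_runs) (use fr assms in \<open>auto simp: s1_def\<close>)
    then have "runs (count_up ''q'' ''r'' ''l'') s1
      (\<lambda>t s''. t + 10 \<le> 36 \<and> I (Suc j) (set_reg ''x'' (Suc (reg s'' ''x'')) s''))"
      by (rule runs_mono) (use 1 fr in \<open>auto simp: I_def frame_def s1_def less_Suc_eq\<close>)
    then show ?case using 1 fr
      by (auto simp: runs_simps incr_def s1_def elim!: runs_mono)
  next
    case (2 s')
    then show ?case using assms by (simp_all add: I_def frame_def)
  next
    case 3
    then show ?case using assms by (simp add: I_def frame_def)
  next
    case (4 t s')
    then show ?case by (simp add: I_def algebra_simps)
  qed
qed

text \<open>A number \<open>x < l ^ (B + 1)\<close> stands for a colouring of the vertices \<open>i - B, \<dots>, i\<close>: its base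
  \<open>l\<close> digits from the least significant one on are the colours in this order. Thus \<open>x mod l ^ B\<close>
  describes the window before vertex \<open>i\<close>, \<open>x div l ^ B\<close> is the colour of \<open>i\<close>, and \<open>x div l\<close>
  describes the window before \<open>i + 1\<close>.\<close>

definition window_ok :: "nat \<Rightarrow> nat \<Rightarrow> nat set \<Rightarrow> nat set \<Rightarrow> nat set \<Rightarrow> nat \<Rightarrow> nat \<Rightarrow> bool" where
  "window_ok l B S L D w c \<longleftrightarrow>
     w \<in> S \<and> c \<in> L \<and> (\<forall>d\<in>D. 0 < d \<and> d \<le> B \<longrightarrow> w div l ^ (B - d) mod l \<noteq> c)"

text \<open>The bound \<open>N\<close> is a parameter so that its value \<open>j\<close> describes
  the set built by the first \<open>j\<close> rounds of the loop in \<open>layer\<close>.\<close>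

definition next_windows :: "nat \<Rightarrow> nat \<Rightarrow> nat set \<Rightarrow> nat set \<Rightarrow> nat set \<Rightarrow> nat \<Rightarrow> nat set" where
  "next_windows l B S L D N =
     (\<lambda>x. x div l) ` {x. x < N \<and> window_ok l B S L D (x mod l ^ B) (x div l ^ B)}"

lemma check_window_runs:
  assumes "reg s ''B'' = B" "reg s ''i'' = i" "reg s ''w'' = w" "reg s ''c'' = c"
    and tab: "\<forall>y<N. arr s ''quo'' y = y div l \<and> arr s ''dig'' y = y mod l" and "w < N"
  shows "runs check_window s (\<lambda>t s'. t \<le> B * 30 + 30 \<and> frame {''ok'', ''y'', ''d''} {} {} s s' \<and>
    reg s' ''ok'' = of_bool (window_ok l B (hset s ''S'' i) (hset s ''L'' i) (hset s ''D'' i) w c))"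
proof -
  define I where "I = (\<lambda>j s'. j \<le> B \<and> reg s' ''d'' = B - j \<and> reg s' ''y'' = w div l ^ j \<and>
    frame {''ok'', ''y'', ''d''} {} {} s s' \<and>
    reg s' ''ok'' = of_bool (w \<in> hset s ''S'' i \<and> c \<in> hset s ''L'' i \<and>
      (\<forall>q<j. B - q \<in> hset s ''D'' i \<longrightarrow> w div l ^ q mod l \<noteq> c)))"
  \<comment> \<open>The loop counts the digits \<open>q\<close> already stripped rather than the
    distance \<open>d\<close>; the two are related by \<open>q = B - d\<close>.\<close>
  have eq: "window_ok l B S L D w c \<longleftrightarrow>
    w \<in> S \<and> c \<in> L \<and> (\<forall>q<B. B - q \<in> D \<longrightarrow> w div l ^ q mod l \<noteq> c)" for S L D
  proof -
    have "(\<forall>d\<in>D. 0 < d \<and> d \<le> B \<longrightarrow> w div l ^ (B - d) mod l \<noteq> c) \<longleftrightarrow>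
      (\<forall>q<B. B - q \<in> D \<longrightarrow> w div l ^ q mod l \<noteq> c)"
    proof (intro iffI allI ballI impI)
      fix q assume "\<forall>d\<in>D. 0 < d \<and> d \<le> B \<longrightarrow> w div l ^ (B - d) mod l \<noteq> c" "q < B" "B - q \<in> D"
      then show "w div l ^ q mod l \<noteq> c"
        by (auto dest: bspec[of D _ "B - q"])
    next
      fix d assume "\<forall>q<B. B - q \<in> D \<longrightarrow> w div l ^ q mod l \<noteq> c" "d \<in> D" "0 < d \<and> d \<le> B"
      then show "w div l ^ (B - d) mod l \<noteq> c"
        by (auto dest: spec[of _ "B - d"])
    qed
    then show ?thesis by (simp add: window_ok_def)
  qed
  show ?thesis
    unfolding check_window_def runs_simps
  proof (rule runs_mono, rule runs_while[where n = B and I = I and T = 26], goal_cases)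
    case (1 j s')
    then have F: "frame {''ok'', ''y'', ''d''} {} {} s s'"
      and dy: "reg s' ''d'' = B - j" "reg s' ''y'' = w div l ^ j"
      unfolding I_def by blast+
    have fr: "reg s' ''d'' = B - j" "reg s' ''y'' = w div l ^ j" "reg s' ''i'' = i"
      "reg s' ''c'' = c" "hset s' = hset s" "arr s' = arr s"
      using dy frameD[OF F] assms(2,4) by (simp_all add: fun_eq_iff)
    \<comment> \<open>Every quotient met on the way stays below \<open>N\<close>, so the tables are
      read only where they are filled.\<close>
    have lt: "w div l ^ j < N"
      using \<open>w < N\<close> div_le_dividend le_less_trans by blast
    have quo: "arr s ''quo'' (w div l ^ j) = w div l ^ Suc j" "arr s ''dig'' (w div l ^ j) = w div l ^ j mod l"
      using tab lt by (simp_all add: mult.commute flip: div_mult2_eq)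
    have "B - j > 0" using 1 by simp
    then show ?case using 1 fr quo
      by (auto simp: I_def runs_simps less_Suc_eq frame_def)
  next
    case (2 s')
    then show ?case by (auto simp: I_def)
  next
    case 3
    then show ?case using assms by (simp add: I_def frame_def)
  next
    case (4 t s')
    then show ?case by (auto simp: I_def algebra_simps eq)
  qed
qed

lemma layer_runs:
  assumes "reg s ''B'' = B" "reg s ''i'' = i" "reg s ''N'' = N" "reg s ''P'' = l ^ B" "l > 0"
    and tab: "\<forall>y<N. arr s ''quo'' y = y div l \<and> arr s ''dig'' y = y mod l"
    and empty: "hset s ''S'' (Suc i) = {}"
  shows "runs layer s (\<lambda>t s'. t \<le> N * (B * 30 + 80) + 12 \<and>
    frame {''out'', ''x'', ''c'', ''w'', ''ok'', ''y'', ''d''} {} {''S''} s s' \<and>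
    (\<forall>k. k \<noteq> Suc i \<longrightarrow> hset s' ''S'' k = hset s ''S'' k) \<and>
    hset s' ''S'' (Suc i) = next_windows l B (hset s ''S'' i) (hset s ''L'' i) (hset s ''D'' i) N \<and>
    reg s' ''out'' = of_bool (hset s' ''S'' (Suc i) \<noteq> {}))"
proof -
  define W where "W = next_windows l B (hset s ''S'' i) (hset s ''L'' i) (hset s ''D'' i)"
  define I where "I = (\<lambda>j s'. reg s' ''x'' = j \<and> reg s' ''c'' = j div l ^ B \<and> reg s' ''w'' = j mod l ^ B \<and>
    frame {''out'', ''x'', ''c'', ''w'', ''ok'', ''y'', ''d''} {} {''S''} s s' \<and>
    (\<forall>k. k \<noteq> Suc i \<longrightarrow> hset s' ''S'' k = hset s ''S'' k) \<and> hset s' ''S'' (Suc i) = W j \<and>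
    reg s' ''out'' = of_bool (W j \<noteq> {}))"
  have W0: "W 0 = {}" by (simp add: W_def next_windows_def)
  show ?thesis
    unfolding layer_def runs_simps
  proof (rule runs_mono, rule runs_while[where n = N and I = I and T = "B * 30 + 76"], goal_cases)
    case (1 j s')
    then have fr: "reg s' ''x'' = j" "reg s' ''c'' = j div l ^ B" "reg s' ''w'' = j mod l ^ B"
      "reg s' ''i'' = i" "reg s' ''B'' = B" "reg s' ''N'' = N" "reg s' ''P'' = l ^ B"
      "arr s' = arr s" "hset s' ''S'' i = hset s ''S'' i" "hset s' ''L'' = hset s ''L''"
      "hset s' ''D'' = hset s ''D''"
      using assms by (auto simp: I_def frame_def)
    define ok where "ok = window_ok l B (hset s ''S'' i) (hset s ''L'' i) (hset s ''D'' i) (j mod l ^ B) (j div l ^ B)"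
    have WS: "W (Suc j) = (if ok then insert (j div l) (W j) else W j)"
      by (auto simp: W_def next_windows_def less_Suc_eq ok_def)
    have "j mod l ^ B < N" using 1 by (meson le_less_trans mod_less_eq_dividend)
    then have chk: "runs check_window s' (\<lambda>t s''. t \<le> B * 30 + 30 \<and> frame {''ok'', ''y'', ''d''} {} {} s' s'' \<and>
      reg s'' ''ok'' = of_bool ok)"
      by (intro runs_mono[OF check_window_runs[of s' B i "j mod l ^ B" "j div l ^ B" N l]])
        (use fr tab in \<open>auto simp: ok_def\<close>)
    \<comment> \<open>Both outcomes of the window test lead to a state \<open>s1\<close> of this
      kind, from which the rest of the round restores the invariant.\<close>
    have cnt: "runs (count_up ''c'' ''w'' ''P'') s1
      (\<lambda>t s2. t + 10 \<le> 30 \<and> I (Suc j) (set_reg ''x'' (Suc (reg s2 ''x'')) s2))"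
      if "frame {''ok'', ''y'', ''d'', ''out''} {} {''S''} s' s1"
        "hset s1 ''S'' = (hset s' ''S'')(Suc i := W (Suc j))"
        "reg s1 ''out'' = of_bool (W (Suc j) \<noteq> {})" for s1
    proof -
      have "runs (count_up ''c'' ''w'' ''P'') s1 (\<lambda>t s2. t \<le> 20 \<and> frame {''c'', ''w''} {} {} s1 s2 \<and>
        reg s2 ''c'' = Suc j div reg s1 ''P'' \<and> reg s2 ''w'' = Suc j mod reg s1 ''P'')"
        by (rule count_up_runs) (use fr that assms in \<open>auto simp: frame_def\<close>)
      then show ?thesis
        by (rule runs_mono) (use 1 fr that in \<open>auto simp: I_def frame_def\<close>)
    qed
    let ?Q = "\<lambda>t s2. t + 10 \<le> 30 \<and> I (Suc j) (set_reg ''x'' (Suc (reg s2 ''x'')) s2)"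
    have "runs check_window s' (\<lambda>t s''. t \<le> B * 30 + 30 \<and>
      runs (count_up ''c'' ''w'' ''P'') (if ok then set_reg ''out'' 1
        (set_hset ''S'' (Suc i) (insert (j div l) (hset s'' ''S'' (Suc i))) s'') else s'') ?Q \<and>
      reg s'' ''ok'' = of_bool ok \<and> reg s'' ''x'' = j \<and> reg s'' ''i'' = i \<and> arr s'' = arr s)"
      using chk
    proof (rule runs_mono, elim conjE, intro conjI, goal_cases)
      case (2 t s'')
      then have F: "frame {''ok'', ''y'', ''d''} {} {} s' s''" by simp
      have "hset s'' ''S'' = hset s' ''S''" "hset s' ''S'' (Suc i) = W j" "reg s'' ''out'' = of_bool (W j \<noteq> {})"
        using 1(2) frameD[OF F] by (simp_all add: I_def)
      note S = this
      show ?case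
      proof (cases ok)
        case True
        have "hset s'' ''S'' = (hset s' ''S'')(Suc i := W j)"
          by (simp add: S(1) flip: S(2))
        then show ?thesis
          using F True S by (intro cnt) (simp_all add: frame_def WS)
      next
        case False
        show ?thesis
          using F False S by (intro cnt) (simp_all add: frame_def WS fun_upd_idem)
      qed
    qed (use fr in \<open>auto simp: frame_def\<close>)
    then have "runs (Seq check_window
       (Seq (If (Var ''ok'')
              (Seq (Insert ''S'' (Add (Var ''i'') (Const 1)) (Arr ''quo'' (Var ''x'')))
                (Assign ''out'' (Const 1))) Skip)
       (Seq (count_up ''c'' ''w'' ''P'')
       (incr ''x'')))) s' (\<lambda>t s'. t \<le> B * 30 + 76 \<and> I (Suc j) s')"
      unfolding runs_simps(5)[of check_window]
      by (rule runs_mono)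
        (use 1 tab in \<open>auto simp: runs_simps incr_def split: if_splits elim!: runs_mono\<close>)
    then show ?case using 1 fr by simp
  next
    case (2 s')
    then show ?case using assms by (auto simp: I_def frame_def)
  next
    case 3
    then show ?case using assms by (auto simp: I_def frame_def W0)
  next
    case (4 t s')
    then show ?case by (auto simp: I_def algebra_simps W_def)
  qed
qed

text \<open>What the machine keeps in \<open>S\<close>, as a recursion free of states, so that
  correctness becomes purely combinatorial.\<close>

fun windows :: "nat \<Rightarrow> nat \<Rightarrow> (nat \<Rightarrow> nat set) \<Rightarrow> (nat \<Rightarrow> nat set) \<Rightarrow> nat \<Rightarrow> nat set" where
  "windows l B L D 0 = {0}"
| "windows l B L D (Suc i) = next_windows l B (windows l B L D i) (L i) (D i) (l ^ (B + 1))"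

lemma layers_runs:
  assumes "reg s ''i'' = 0" "reg s ''n'' = n" "reg s ''B'' = B" "reg s ''N'' = l ^ (B + 1)"
    "reg s ''P'' = l ^ B" "l > 0" "hset s ''S'' = (\<lambda>_. {})"
    and tab: "\<forall>y<l ^ (B + 1). arr s ''quo'' y = y div l \<and> arr s ''dig'' y = y mod l"
  shows "runs layers s (\<lambda>t s'. t \<le> n * (l ^ (B + 1) * (B * 30 + 80) + 20) + 10 \<and>
    reg s' ''out'' = of_bool (windows l B (hset s ''L'') (hset s ''D'') n \<noteq> {}))"
proof -
  define W where "W = windows l B (hset s ''L'') (hset s ''D'')"
  \<comment> \<open>The later sets are recorded as empty because \<open>layer\<close> only inserts
    into its target.\<close>
  define I where "I = (\<lambda>j s'. reg s' ''i'' = j \<and>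
    frame {''i'', ''out'', ''x'', ''c'', ''w'', ''ok'', ''y'', ''d''} {} {''S''} s s' \<and>
    (\<forall>k>j. hset s' ''S'' k = {}) \<and> hset s' ''S'' j = W j \<and> reg s' ''out'' = of_bool (W j \<noteq> {}))"
  show ?thesis
    unfolding layers_def runs_simps
  proof (rule runs_mono,
      rule runs_while[where n = n and I = I and T = "l ^ (B + 1) * (B * 30 + 80) + 16"], goal_cases)
    case (1 j s')
    then have fr: "reg s' ''i'' = j" "reg s' ''B'' = B" "reg s' ''N'' = l ^ (B + 1)"
      "reg s' ''P'' = l ^ B" "reg s' ''n'' = n" "arr s' = arr s" "hset s' ''L'' = hset s ''L''"
      "hset s' ''D'' = hset s ''D''" "hset s' ''S'' j = W j" "hset s' ''S'' (Suc j) = {}"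
      using assms by (auto simp: I_def frame_def)
    have "runs layer s' (\<lambda>t s''. t + 4 \<le> l ^ (B + 1) * (B * 30 + 80) + 16 \<and>
      I (Suc j) (set_reg ''i'' (Suc (reg s'' ''i'')) s''))"
      by (rule runs_mono, rule layer_runs[where B = B and i = j and N = "l ^ (B + 1)" and l = l])
        (use 1 fr assms in \<open>auto simp: I_def frame_def W_def\<close>)
    then show ?case using 1 fr
      by (auto simp: runs_simps incr_def elim!: runs_mono)
  next
    case (2 s')
    then show ?case using assms by (auto simp: I_def frame_def)
  next
    case 3
    then show ?case using assms by (auto simp: I_def frame_def W_def)
  next
    case (4 t s')
    then show ?case by (auto simp: I_def algebra_simps W_def)
  qed
qed


section \<open>Windows and colourings\<close>

text \<open>The new colour is pushed in at digit position \<open>B\<close>, then all digits move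
  down and the oldest is dropped. Missing vertices at the start count as colour 0.\<close>

fun window :: "nat \<Rightarrow> nat \<Rightarrow> (nat \<Rightarrow> nat) \<Rightarrow> nat \<Rightarrow> nat" where
  "window l B a 0 = 0"
| "window l B a (Suc i) = (window l B a i + a i * l ^ B) div l"

lemma window_cong: "(\<And>j. j < i \<Longrightarrow> a j = b j) \<Longrightarrow> window l B a i = window l B b i"
  by (induction i) auto

text \<open>By this bound, a window and the next colour can be recovered from their joint code by
  division by \<open>l ^ B\<close>.\<close>

lemma window_less:
  assumes "\<And>j. j < i \<Longrightarrow> a j < l" "l > 0"
  shows "window l B a i < l ^ B"
  using assms
proof (induction i)
  case (Suc i)
  then have "window l B a i < l ^ B" "Suc (a i) \<le> l" by (auto simp: Suc_le_eq)
  then have "window l B a i + a i * l ^ B < Suc (a i) * l ^ B" "Suc (a i) * l ^ B \<le> l * l ^ B"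
    by (simp, intro mult_right_mono) auto
  then show ?case
    using Suc.prems by (simp add: div_less_iff_less_mult mult.commute)
qed simp

text \<open>Each step shifts the digits down by one place, so the colour pushed in \<open>d\<close>
  steps ago has moved from position \<open>B\<close> to \<open>B - d\<close>.\<close>

lemma window_digit:
  assumes "\<And>j. j < i \<Longrightarrow> a j < l" "l > 0" "0 < d" "d \<le> B" "d \<le> i"
  shows "window l B a i div l ^ (B - d) mod l = a (i - d)"
  using assms
proof (induction i arbitrary: d)
  case (Suc i)
  have lt: "window l B a i < l ^ B" using Suc.prems by (intro window_less) auto
  have eq: "window l B a (Suc i) div l ^ (B - d) = (window l B a i + a i * l ^ B) div l ^ (B - (d - 1))"
    using Suc.prems by (simp add: Suc_diff_le flip: div_mult2_eq power_Suc)
  show ?case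
  proof (cases "d = 1")
    case True
    then show ?thesis unfolding eq using lt Suc.prems by simp
  next
    case False
    \<comment> \<open>For an older vertex the newly pushed colour must not disturb the digit: what
      it adds here is a multiple of \<open>l\<close>, as \<open>d - 1 > 0\<close>.\<close>
    have "l ^ B = l ^ (d - 1) * l ^ (B - (d - 1))"
      using Suc.prems by (simp flip: power_add)
    then have "(window l B a i + a i * l ^ B) div l ^ (B - (d - 1)) =
      window l B a i div l ^ (B - (d - 1)) + a i * l ^ (d - 1)"
      using Suc.prems by (simp add: mult.assoc [symmetric])
    moreover have "l dvd a i * l ^ (d - 1)"
      using False Suc.prems by (intro dvd_mult dvd_power) auto
    then obtain k where "a i * l ^ (d - 1) = l * k" ..
    moreover have "window l B a i div l ^ (B - (d - 1)) mod l = a (i - (d - 1))"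
      using Suc.prems False by (intro Suc.IH) auto
    moreover have "i - (d - 1) = Suc i - d" using Suc.prems by simp
    ultimately show ?thesis
      unfolding eq by simp
  qed
qed simp

section \<open>Correctness of the dynamic programming\<close>

text \<open>Each conflict is tested from its later vertex, by distance; 0 is skipped because
  scanning the edges leaves it behind.\<close>

definition proper :: "(nat \<Rightarrow> nat set) \<Rightarrow> (nat \<Rightarrow> nat set) \<Rightarrow> nat \<Rightarrow> (nat \<Rightarrow> nat) \<Rightarrow> bool" where
  "proper L D i a \<longleftrightarrow> (\<forall>j<i. a j \<in> L j \<and> (\<forall>d\<in>D j. 0 < d \<longrightarrow> a (j - d) \<noteq> a j))"

text \<open>A proper prefix influences its extensions only through its window, as no distance
  exceeds \<open>B\<close>. Prefixes with equal windows are therefore interchangeable, and the set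
  of windows may replace the set of prefixes.\<close>

lemma windows_eq:
  assumes "l > 0" and L: "\<And>j. L j \<subseteq> {..<l}" and D: "\<And>j. j < i \<Longrightarrow> D j \<subseteq> {..min j B}"
  shows "windows l B L D i = (\<lambda>a. window l B a i) ` {a. proper L D i a}"
  using D
proof (induction i)
  case 0
  then show ?case by (auto simp: proper_def)
next
  case (Suc i)
  have IH: "windows l B L D i = (\<lambda>a. window l B a i) ` {a. proper L D i a}"
    using Suc by simp
  \<comment> \<open>The digits compared are colours of actual vertices rather than padding, because
    distances in \<open>D i\<close> are also at most \<open>i\<close>.\<close>
  have ok: "window_ok l B (windows l B L D i) (L i) (D i) (window l B a i) (a i) \<longleftrightarrow> proper L D (Suc i) a"
    if "proper L D i a" for a
  proof -
    have "window l B a i div l ^ (B - d) mod l = a (i - d)" if "d \<in> D i" "0 < d" for d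
    proof (rule window_digit)
      show "a j < l" if "j < i" for j using that \<open>proper L D i a\<close> L by (auto simp: proper_def)
    qed (use Suc.prems[of i] that \<open>l > 0\<close> in auto)
    moreover have "d \<le> B" if "d \<in> D i" for d
      using Suc.prems[of i] that by auto
    ultimately show ?thesis
      using that unfolding window_ok_def IH proper_def by (auto simp: less_Suc_eq)
  qed
  show ?case
  proof (intro equalityI subsetI)
    fix y assume "y \<in> windows l B L D (Suc i)"
    then obtain x where x: "y = x div l"
      "window_ok l B (windows l B L D i) (L i) (D i) (x mod l ^ B) (x div l ^ B)"
      by (auto simp: next_windows_def)
    then obtain a where a: "proper L D i a" "x mod l ^ B = window l B a i"
      by (auto simp: window_ok_def IH)
    \<comment> \<open>The prefix behind the window says nothing about vertex \<open>i\<close>; the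
      top digit of \<open>x\<close> supplies its colour and leaves the window before
      \<open>i\<close> unchanged.\<close>
    define b where "b = a(i := x div l ^ B)"
    have b: "window l B b i = x mod l ^ B" "b i = x div l ^ B"
      using a(2) window_cong[of i a b l B] by (auto simp: b_def)
    have "proper L D i b"
      using a(1) by (auto simp: proper_def b_def)
    then have "proper L D (Suc i) b"
      using ok[of b] x(2) b by simp
    moreover have "y = window l B b (Suc i)"
      using b x(1) by (simp add: mod_div_mult_eq)
    ultimately show "y \<in> (\<lambda>a. window l B a (Suc i)) ` {a. proper L D (Suc i) a}"
      by blast
  next
    fix y assume "y \<in> (\<lambda>a. window l B a (Suc i)) ` {a. proper L D (Suc i) a}"
    then obtain a where a: "proper L D (Suc i) a" "y = window l B a (Suc i)" by blast
    then have "proper L D i a" by (simp add: proper_def)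
    have "a j < l" if "j < Suc i" for j
      using a(1) L[of j] that by (auto simp: proper_def)
    then have lt: "window l B a i < l ^ B" "a i < l"
      using \<open>l > 0\<close> by (auto intro: window_less)
    define x where "x = window l B a i + a i * l ^ B"
    have x: "x mod l ^ B = window l B a i" "x div l ^ B = a i"
      using lt by (simp_all add: x_def)
    then have "x < l ^ (B + 1)"
      using lt \<open>l > 0\<close> by (metis add.commute div_less_iff_less_mult plus_1_eq_Suc power_Suc zero_less_power)
    then show "y \<in> windows l B L D (Suc i)"
      using ok[OF \<open>proper L D i a\<close>] a x by (auto simp: next_windows_def x_def)
  qed
qed

section \<open>Edges, bandwidth and colourability in terms of positions\<close>

text \<open>In a repetition-free order vertices determine their positions, so equality of
  two-element sets becomes equality of pairs up to orientation.\<close>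

lemma edge_iff:
  assumes "distinct vs" "edge_list vs E es" "i < length vs" "j < length vs"
  shows "{vs ! i, vs ! j} \<in> E \<longleftrightarrow> (\<exists>k<length es. es ! k = (i, j) \<or> es ! k = (j, i))"
proof -
  have E: "E = (\<lambda>k. {vs ! fst (es ! k), vs ! snd (es ! k)}) ` {..<length es}"
    using assms(2) by (auto simp: edge_list_def bij_betw_def)
  have "{vs ! i, vs ! j} = {vs ! fst (es ! k), vs ! snd (es ! k)} \<longleftrightarrow> es ! k = (i, j) \<or> es ! k = (j, i)"
    if "k < length es" for k
  proof -
    obtain p q where pq: "es ! k = (p, q)" by fastforce
    have "p < length vs" "q < length vs"
      using assms(2) nth_mem[OF that] pq by (auto simp: edge_list_def)
    then show ?thesis
      using assms(1,3,4) by (auto simp: pq doubleton_eq_iff nth_eq_iff_index_eq)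
  qed
  then show ?thesis
    unfolding E image_iff by auto
qed

text \<open>An edge has the same length in both orientations, so listing it in one of them is
  enough.\<close>

lemma bandwidth_eq:
  assumes "distinct vs" "edge_list vs E es"
  shows "bandwidth vs E =
    Max (insert 0 ((\<lambda>(i, j). (i - j) + (j - i)) ` set es))"
proof -
  have "{nat \<bar>int i - int j\<bar> | i j. i < length vs \<and> j < length vs \<and> {vs ! i, vs ! j} \<in> E} =
    (\<lambda>(i, j). (i - j) + (j - i)) ` set es" (is "?A = ?B")
  proof (intro equalityI subsetI)
    fix d assume "d \<in> ?A"
    then obtain i j where ij: "d = nat \<bar>int i - int j\<bar>" "i < length vs" "j < length vs" "{vs ! i, vs ! j} \<in> E"
      by blast
    then obtain k where "k < length es" "es ! k = (i, j) \<or> es ! k = (j, i)"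
      using edge_iff[OF assms ij(2,3)] by blast
    then have "(i, j) \<in> set es \<or> (j, i) \<in> set es"
      by (metis nth_mem)
    moreover have "d = (i - j) + (j - i)" "d = (j - i) + (i - j)" using ij(1) by auto
    ultimately show "d \<in> ?B" by force
  next
    fix d assume "d \<in> ?B"
    then obtain i j where ij: "(i, j) \<in> set es" "d = (i - j) + (j - i)" by auto
    then have lt: "i < length vs" "j < length vs"
      using assms(2) by (auto simp: edge_list_def)
    moreover have "{vs ! i, vs ! j} \<in> E"
      unfolding edge_iff[OF assms lt] using ij(1) by (auto simp: in_set_conv_nth)
    moreover have "d = nat \<bar>int i - int j\<bar>" using ij(2) by auto
    ultimately show "d \<in> ?A" by blast
  qed
  then show ?thesis by (simp add: bandwidth_def)
qed

text \<open>Without loops every edge joins two different positions, so it is seen as a positive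
  distance from its later endpoint.\<close>

lemma list_colorable_iff_proper:
  assumes "simple_graph V E" "vertex_order V vs"
    and L': "\<And>i. i < length vs \<Longrightarrow> L' i = L (vs ! i)"
    and D: "\<And>i d. i < length vs \<Longrightarrow> 0 < d \<Longrightarrow> d \<in> D i \<longleftrightarrow> d \<le> i \<and> {vs ! (i - d), vs ! i} \<in> E"
  shows "list_colorable V E L \<longleftrightarrow> (\<exists>a. proper L' D (length vs) a)"
proof
  assume "list_colorable V E L"
  then obtain a where a: "\<forall>v\<in>V. a v \<in> L v" "\<forall>u v. {u, v} \<in> E \<longrightarrow> a u \<noteq> a v"
    by (auto simp: list_colorable_def)
  have "proper L' D (length vs) (\<lambda>i. a (vs ! i))"
    using a assms(2) by (auto simp: proper_def L' D vertex_order_def)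
  then show "\<exists>a. proper L' D (length vs) a" by blast
next
  assume "\<exists>a. proper L' D (length vs) a"
  then obtain a where a: "proper L' D (length vs) a" ..
  \<comment> \<open>A colouring of positions is carried to the vertices by inverting the
    order.\<close>
  define b where "b = (\<lambda>v. a (THE i. i < length vs \<and> vs ! i = v))"
  have b: "b (vs ! i) = a i" if "i < length vs" for i
  proof -
    have "(THE k. k < length vs \<and> vs ! k = vs ! i) = i"
      using that assms(2) by (intro the_equality) (auto simp: vertex_order_def nth_eq_iff_index_eq)
    then show ?thesis by (simp add: b_def)
  qed
  have lt: "a i \<noteq> a j" if "i < j" "j < length vs" "{vs ! i, vs ! j} \<in> E" for i j
  proof -
    have "\<forall>d\<in>D j. 0 < d \<longrightarrow> a (j - d) \<noteq> a j"
      using a that(2) by (simp add: proper_def)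
    moreover have "j - i \<in> D j" using D[of j "j - i"] that by simp
    ultimately show ?thesis using that(1) by (auto dest!: bspec)
  qed
  have "b u \<noteq> b v" if "{u, v} \<in> E" for u v
  proof -
    have "u \<in> V" "v \<in> V" "u \<noteq> v"
      using assms(1) that by (auto simp: simple_graph_def)
    moreover from this obtain i j where ij: "i < length vs" "u = vs ! i" "j < length vs" "v = vs ! j"
      using assms(2) unfolding vertex_order_def by (metis in_set_conv_nth)
    ultimately have "i \<noteq> j" by blast
    then have "i < j \<or> j < i" by (rule nat_neq_iff[THEN iffD1])
    with ij show ?thesis
      using lt[of i j] lt[of j i] that by (auto simp: b insert_commute)
  qed
  moreover have "b v \<in> L v" if "v \<in> V" for v
  proof -
    have "v \<in> set vs" using that assms(2) by (simp add: vertex_order_def)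
    then obtain i where "i < length vs" "v = vs ! i" by (auto simp: in_set_conv_nth)
    then show ?thesis using a by (auto simp: b proper_def L')
  qed
  ultimately show "list_colorable V E L"
    by (auto simp: list_colorable_def)
qed

section \<open>Correctness and cost of the whole program\<close>

lemma color_prog_runs:
  fixes l :: nat
  assumes G: "simple_graph V E" "vertex_order V vs" "edge_list vs E es" "\<forall>v\<in>V. L v \<subseteq> {0..<l}"
    and pos: "l > 0" "vs \<noteq> []"
  defines "B \<equiv> bandwidth vs E"
  shows "runs color_prog (input_state l vs es L) (\<lambda>t s. answer s = of_bool (list_colorable V E L) \<and>
    t \<le> length es * 50 + (B + 1) * (l * 12 + 30) + l ^ (B + 1) * 40 +
      length vs * (l ^ (B + 1) * (B * 30 + 80) + 20) + 60)"
proof -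
  define s where "s = input_state l vs es L"
  define e where "e = arr s ''eu''"
  define f where "f = arr s ''ev''"
  define D where "D = (\<lambda>i. {e k - f k | k. k < length es \<and> e k = i} \<union> {f k - e k | k. k < length es \<and> f k = i})"
  have s: "reg s ''n'' = length vs" "reg s ''m'' = length es" "reg s ''l'' = l"
    "reg s ''k'' = 0" "reg s ''B'' = 0" "reg s ''b'' = 0" "reg s ''x'' = 0" "reg s ''q'' = 0" "reg s ''r'' = 0"
    "reg s ''i'' = 0" "hset s ''D'' = (\<lambda>_. {})" "hset s ''S'' = (\<lambda>_. {})"
    "hset s ''L'' = (\<lambda>i. if i < length vs then L (vs ! i) else {})"
    by (simp_all add: s_def input_state_def)
  have ef: "(e k, f k) = es ! k" if "k < length es" for k
    using that by (simp add: e_def f_def s_def input_state_def)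
  have vs: "distinct vs" using G(2) by (simp add: vertex_order_def)
  have dist: "(\<lambda>k. (e k - f k) + (f k - e k)) ` {..<length es} = (\<lambda>(i, j). (i - j) + (j - i)) ` set es"
    by (force simp: set_conv_nth image_def simp flip: ef)
  then have B: "B = Max (insert 0 ((\<lambda>k. (e k - f k) + (f k - e k)) ` {..<length es}))"
    using bandwidth_eq[OF vs G(3)] by (simp add: B_def)
  have le: "(e k - f k) + (f k - e k) \<le> B" if "k < length es" for k
    unfolding B using that by (intro Max_ge) auto
  \<comment> \<open>A truncated difference is at most its minuend, here \<open>j\<close>, and at
    most the length of the edge.\<close>
  have DB: "D j \<subseteq> {..min j B}" for j
    using le by (force simp: D_def)
  have D: "d \<in> D i \<longleftrightarrow> d \<le> i \<and> {vs ! (i - d), vs ! i} \<in> E" if "i < length vs" "0 < d" for i d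
  proof -
    have "d \<in> D i \<longleftrightarrow> d \<le> i \<and> (\<exists>k<length es. (e k, f k) = (i - d, i) \<or> (e k, f k) = (i, i - d))"
    proof
      assume "d \<in> D i"
      then show "d \<le> i \<and> (\<exists>k<length es. (e k, f k) = (i - d, i) \<or> (e k, f k) = (i, i - d))"
        using that(2) by (auto simp: D_def)
    next
      assume "d \<le> i \<and> (\<exists>k<length es. (e k, f k) = (i - d, i) \<or> (e k, f k) = (i, i - d))"
      then obtain k where "k < length es" "e k = i \<and> d = e k - f k \<or> f k = i \<and> d = f k - e k"
        by auto
      then show "d \<in> D i"
        unfolding D_def by blast
    qed
    also have "\<dots> \<longleftrightarrow> d \<le> i \<and> (\<exists>k<length es. es ! k = (i - d, i) \<or> es ! k = (i, i - d))"
      by (simp only: ef cong: conj_cong)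
    finally show ?thesis
      using edge_iff[OF vs G(3), of "i - d" i] that by auto
  qed
  have LL: "hset s ''L'' j \<subseteq> {..<l}" for j
  proof (cases "j < length vs")
    case True
    then have "vs ! j \<in> V"
      using G(2) by (auto simp: vertex_order_def)
    then show ?thesis using G(4) True by (simp add: s lessThan_atLeast0)
  qed (simp add: s)
  have "list_colorable V E L \<longleftrightarrow> (\<exists>a. proper (hset s ''L'') D (length vs) a)"
    by (rule list_colorable_iff_proper[OF G(1,2) _ D]) (simp_all add: s)
  also have "\<dots> \<longleftrightarrow> windows l B (hset s ''L'') D (length vs) \<noteq> {}"
    using windows_eq[OF pos(1) LL DB] by auto
  finally have col: "list_colorable V E L \<longleftrightarrow> windows l B (hset s ''L'') D (length vs) \<noteq> {}" .
  \<comment> \<open>The fixed costs of the four stages sum to 28; the further 30 in the final claim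
    pay for the two initial tests.\<close>
  have "runs (Seq scan_edges (Seq powers (Seq tables layers))) s
    (\<lambda>t s'. reg s' ''out'' = of_bool (list_colorable V E L) \<and>
      t \<le> length es * 50 + (B + 1) * (l * 12 + 30) + l ^ (B + 1) * 40 +
        length vs * (l ^ (B + 1) * (B * 30 + 80) + 20) + 30)"
    unfolding runs_simps(5)
  proof (rule runs_mono[OF scan_edges_runs[OF s(4,5,11,2)]], goal_cases)
    case (1 t1 s1)
    have D1: "hset s1 ''D'' = D" "reg s1 ''B'' = B"
      using 1 by (simp_all add: D_def e_def f_def B fun_eq_iff)
    have f1: "frame {''k'', ''d'', ''B''} {} {''D''} s s1" and t1: "t1 \<le> length es * 50 + 4"
      using 1 by auto
    have b1: "reg s1 ''b'' = 0" "reg s1 ''l'' = l"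
      using s frameD(1)[OF f1] by simp_all
    show ?case
    proof (rule runs_mono[OF powers_runs[OF b1(1) D1(2) b1(2)]], goal_cases)
      case (1 t2 s2)
      then have f2: "frame {''N'', ''P'', ''b'', ''j''} {} {} s1 s2"
        and t2: "t2 \<le> (B + 1) * (l * 12 + 30) + 10"
        and P2: "reg s2 ''P'' = l ^ B" "reg s2 ''N'' = l ^ (B + 1)" by auto
      have b2: "reg s2 ''x'' = 0" "reg s2 ''q'' = 0" "reg s2 ''r'' = 0" "reg s2 ''l'' = l"
        using s frameD(1)[OF f1] frameD(1)[OF f2] by simp_all
      show ?case
      proof (rule runs_mono[OF tables_runs[OF b2 P2(2) pos(1)]], goal_cases)
        case (1 t3 s3)
        then have f3: "frame {''x'', ''q'', ''r''} {''quo'', ''dig''} {} s2 s3"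
          and t3: "t3 \<le> l ^ (B + 1) * 40 + 4"
          and tab: "\<forall>y<l ^ (B + 1). arr s3 ''quo'' y = y div l \<and> arr s3 ''dig'' y = y mod l"
          by auto
        have b3: "reg s3 ''i'' = 0" "reg s3 ''n'' = length vs" "reg s3 ''B'' = B"
          "reg s3 ''N'' = l ^ (B + 1)" "reg s3 ''P'' = l ^ B"
          using s P2 D1 frameD(1)[OF f1] frameD(1)[OF f2] frameD(1)[OF f3] by simp_all
        have h3: "hset s3 ''S'' = (\<lambda>_. {})" "hset s3 ''L'' = hset s ''L''" "hset s3 ''D'' = D"
          using s(12) D1 frameD(3)[OF f1] frameD(3)[OF f2] frameD(3)[OF f3] by simp_all
        show ?case
          by (rule runs_mono[OF layers_runs[OF b3 pos(1) h3(1) tab]])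
            (use t1 t2 t3 in \<open>auto simp: col h3\<close>)
      qed
    qed
  qed
  moreover have "length vs \<noteq> 0" using pos by simp
  ultimately show ?thesis
    unfolding s_def[symmetric] color_prog_def answer_def using pos s
    by (auto simp: runs_simps(6) elim: runs_mono)
qed

text \<open>Without vertices the colouring condition is vacuous; without colours a single vertex
  already has an empty list.\<close>

lemma color_prog_trivial:
  fixes l :: nat
  assumes "simple_graph V E" "vertex_order V vs" "\<forall>v\<in>V. L v \<subseteq> {0..<l}" "l = 0 \<or> vs = []"
  shows "runs color_prog (input_state l vs es L) (\<lambda>t s. answer s = of_bool (list_colorable V E L) \<and> t \<le> 20)"
proof (cases "vs = []")
  case True
  then have V: "V = {}" using assms(2) by (simp add: vertex_order_def)
  then have "E = {} \<or> E = {{}}" using assms(1) by (auto simp: simple_graph_def)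
  then have "list_colorable V E L" using V by (auto simp: list_colorable_def)
  then show ?thesis
    using True by (auto simp: color_prog_def runs_simps answer_def input_state_def)
next
  case False
  then have "hd vs \<in> V" using assms(2) by (auto simp: vertex_order_def)
  then have "L (hd vs) = {}" using assms(3,4) False by simp
  then have "\<not> list_colorable V E L"
    using \<open>hd vs \<in> V\<close> unfolding list_colorable_def by blast
  then show ?thesis
    using False assms(4) by (auto simp: color_prog_def runs_simps answer_def input_state_def)
qed

text \<open>The factor \<open>2 ^ (B + 2)\<close> absorbs \<open>B + 1\<close>, which stems from the
  inner loop. As \<open>l\<close> and \<open>n\<close> are positive, the terms free of
  \<open>m\<close> fit under \<open>l * n\<close>.\<close>

lemma cost_bound:
  fixes l n m B :: nat
  assumes "l > 0" "n > 0"
  shows "m * 50 + (B + 1) * (l * 12 + 30) + l ^ (B + 1) * 40 + n * (l ^ (B + 1) * (B * 30 + 80) + 20) + 60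
    \<le> 400 * ((2 * l) ^ (B + 2) * (m + l * n))"
proof -
  define Z where "Z = (2 * l) ^ (B + 2)"
  have B: "B + 1 \<le> 2 ^ B" by (simp add: Suc_leI)
  have Z: "Z = 2 ^ (B + 2) * l ^ (B + 2)" by (simp add: Z_def power_mult_distrib)
  have B2: "B + 1 \<le> 2 ^ (B + 2)" using B by simp
  have "(B + 1) * l ^ (B + 1) \<le> Z"
    unfolding Z using assms(1) by (intro mult_le_mono[OF B2] power_increasing) simp_all
  then have 1: "l ^ (B + 1) * (B * 30 + 80) \<le> 80 * Z" "l ^ (B + 1) * 40 \<le> 40 * Z"
    by (simp_all add: algebra_simps)
  have "(B + 1) * l \<le> Z"
    unfolding Z using assms(1) by (intro mult_le_mono[OF B2] self_le_power) simp_all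
  then have 2: "(B + 1) * (l * 12 + 30) \<le> 42 * Z"
    using mult_le_mono2[of "l * 12 + 30" "42 * l" "B + 1"] assms(1) by simp
  have 3: "1 \<le> Z" using assms(1) by (simp add: Z_def)
  have 4: "n * (l ^ (B + 1) * (B * 30 + 80) + 20) \<le> n * (100 * Z)"
    using 1 3 by (intro mult_le_mono2) simp
  have 5: "m * 50 \<le> m * (50 * Z)"
    using 3 by (intro mult_le_mono2) simp
  have "m * 50 + (B + 1) * (l * 12 + 30) + l ^ (B + 1) * 40 + n * (l ^ (B + 1) * (B * 30 + 80) + 20) + 60
    \<le> m * (50 * Z) + 42 * Z + 40 * Z + n * (100 * Z) + 60 * Z"
    using 3 by (intro add_mono 5 2 1(2) 4) simp
  \<comment> \<open>In multiples of \<open>Z\<close> the coefficients are 50 for \<open>m\<close>,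
    142 for 1 and 100 for \<open>n\<close>; the last two together stay below 400 for
    \<open>l * n\<close>.\<close>
  also have "\<dots> \<le> 400 * (Z * (m + l * n))"
  proof -
    have "Z * 1 \<le> Z * (l * n)" "Z * n \<le> Z * (l * n)"
      using assms by (intro mult_le_mono2; simp)+
    moreover have "50 * p + 142 * q + 100 * r \<le> 400 * p + 400 * w" if "q \<le> w" "r \<le> w" for p q r w :: nat
      using that by linarith
    ultimately have "50 * (Z * m) + 142 * (Z * 1) + 100 * (Z * n) \<le> 400 * (Z * m) + 400 * (Z * (l * n))"
      by blast
    then show ?thesis by (simp add: algebra_simps)
  qed
  finally show ?thesis by (simp add: Z_def)
qed

theorem corollary3p4:
  "\<exists>(c :: com) (C :: nat). \<forall>(V :: 'v set) E vs es (l :: nat) L.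
     simple_graph V E \<longrightarrow> vertex_order V vs \<longrightarrow> edge_list vs E es \<longrightarrow>
     (\<forall>v\<in>V. L v \<subseteq> {0..<l}) \<longrightarrow>
     (\<exists>t s. big_step c (input_state l vs es L) t s \<and>
        answer s = of_bool (list_colorable V E L) \<and>
        t \<le> C * max 1 ((2 * l) ^ (bandwidth vs E + 2) * (card E + l * card V)))"
proof (rule exI[of _ color_prog], rule exI[of _ 400], intro allI impI)
  fix V :: "'v set" and E vs es and l :: nat and L
  assume G: "simple_graph V E" "vertex_order V vs" "edge_list vs E es" "\<forall>v\<in>V. L v \<subseteq> {0..<l}"
  have n: "card V = length vs" using G(2) by (auto simp: vertex_order_def distinct_card)
  have m: "card E = length es" using G(3) bij_betw_same_card by (fastforce simp: edge_list_def)
  have "runs color_prog (input_state l vs es L) (\<lambda>t s. answer s = of_bool (list_colorable V E L) \<and>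
    t \<le> 400 * max 1 ((2 * l) ^ (bandwidth vs E + 2) * (card E + l * card V)))"
  proof (cases "l = 0 \<or> vs = []")
    case True
    \<comment> \<open>Here the product in the bound is 0, and the constant running time is covered
      by the 1 in \<open>max\<close>.\<close>
    show ?thesis
      by (rule runs_mono[OF color_prog_trivial[OF G(1,2,4) True]]) auto
  next
    case False
    then have pos: "l > 0" "vs \<noteq> []" "length vs > 0" by auto
    show ?thesis
    proof (rule runs_mono[OF color_prog_runs[OF G pos(1,2)]], elim conjE, intro conjI)
      fix t
      assume "t \<le> length es * 50 + (bandwidth vs E + 1) * (l * 12 + 30) + l ^ (bandwidth vs E + 1) * 40 +
        length vs * (l ^ (bandwidth vs E + 1) * (bandwidth vs E * 30 + 80) + 20) + 60"
      also note cost_bound[OF pos(1,3)]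
      also have "400 * ((2 * l) ^ (bandwidth vs E + 2) * (length es + l * length vs)) \<le>
        400 * max 1 ((2 * l) ^ (bandwidth vs E + 2) * (card E + l * card V))"
        unfolding n m by (intro mult_le_mono2 max.cobounded2)
      finally show "t \<le> 400 * max 1 ((2 * l) ^ (bandwidth vs E + 2) * (card E + l * card V))" .
    qed
  qed
  then show "\<exists>t s. big_step color_prog (input_state l vs es L) t s \<and>
        answer s = of_bool (list_colorable V E L) \<and>
        t \<le> 400 * max 1 ((2 * l) ^ (bandwidth vs E + 2) * (card E + l * card V))"
    by (simp add: runs_def)
qed

end
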